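(* Any $5$-path-degenerate graph $G$ has a $3$-segment representation.
   Context: All graphs are finite and simple. For an integer $p\ge 1$, a graph $G$ is $p$-path-degenerate if every non-empty subgraph $H$ of $G$ contains a vertex of degree at most $1$ in $H$, or a path with $p$ internal vertices, each having degree two in $H$. A $3$-box is a cartesian product $I_1\times I_2\times I_3$ of three closed bounded intervals of $\mathbb{R}$. A $3$-box representation of a graph $G=(V,E)$ is a collection $(B_v)_{v\in V}$ of $3$-boxes in $\mathbb{R}^3$ such that for any two distinct vertices $u,v$, $B_u\cap B_v\neq\emptyset$ if and only if $u$ and $v$ are adjacent in $G$. A $3$-box representation of $G$ is called a $3$-segment representation if (1) each vertex is mapped to a segment, that is, the cartesian product (in some order of the coordinates) of two points and one interval of positive length; (2) the interiors of any two segments are disjoint, and in fact the interior of a segment is only intersected by endpoints of other segments; and (3) no two segments lie on the same line. *)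

theory Defs
  imports "HOL-Analysis.Analysis"
begin

definition simple_graph :: "'a set \<Rightarrow> 'a set set \<Rightarrow> bool" where
  "simple_graph V E \<longleftrightarrow> finite V \<and> (\<forall>e\<in>E. e \<subseteq> V \<and> card e = 2)"

text \<open>Subgraphs are arbitrary, not necessarily induced.\<close>

definition subgraph :: "'a set \<Rightarrow> 'a set set \<Rightarrow> 'a set \<Rightarrow> 'a set set \<Rightarrow> bool" where
  "subgraph W F V E \<longleftrightarrow> simple_graph W F \<and> W \<subseteq> V \<and> F \<subseteq> E"

definition degree :: "'a set set \<Rightarrow> 'a \<Rightarrow> nat" where
  "degree E v = card {e \<in> E. v \<in> e}"

text \<open>All vertices of a path are distinct, the two ends included.\<close>

definition graph_path :: "'a set \<Rightarrow> 'a set set \<Rightarrow> 'a list \<Rightarrow> bool" where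
  "graph_path V E xs \<longleftrightarrow> xs \<noteq> [] \<and> distinct xs \<and> set xs \<subseteq> V \<and>
     (\<forall>i. Suc i < length xs \<longrightarrow> {xs ! i, xs ! Suc i} \<in> E)"

definition path_degenerate :: "nat \<Rightarrow> 'a set \<Rightarrow> 'a set set \<Rightarrow> bool" where
  "path_degenerate p V E \<longleftrightarrow>
     (\<forall>W F. subgraph W F V E \<and> W \<noteq> {} \<longrightarrow>
        (\<exists>v\<in>W. degree F v \<le> 1) \<or>
        (\<exists>xs. graph_path W F xs \<and> length xs = p + 2 \<and>
              (\<forall>i\<in>{1..p}. degree F (xs ! i) = 2)))"

text \<open>The constant \<open>cbox a b\<close> is the product of the intervals \<open>{a $ i..b $ i}\<close>.
  Intervals are taken to be non-empty.\<close>

definition box3 :: "(real^3) set \<Rightarrow> bool" where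
  "box3 S \<longleftrightarrow> (\<exists>a b. (\<forall>i. a $ i \<le> b $ i) \<and> S = cbox a b)"

definition box_rep3 :: "'a set \<Rightarrow> 'a set set \<Rightarrow> ('a \<Rightarrow> (real^3) set) \<Rightarrow> bool" where
  "box_rep3 V E B \<longleftrightarrow> (\<forall>v\<in>V. box3 (B v)) \<and>
     (\<forall>u\<in>V. \<forall>v\<in>V. u \<noteq> v \<longrightarrow> (B u \<inter> B v \<noteq> {} \<longleftrightarrow> {u, v} \<in> E))"

definition segment3 :: "(real^3) set \<Rightarrow> bool" where
  "segment3 S \<longleftrightarrow>
     (\<exists>k a b. a $ k < b $ k \<and> (\<forall>i. i \<noteq> k \<longrightarrow> a $ i = b $ i) \<and> S = cbox a b)"

definition endpoints :: "(real^3) set \<Rightarrow> (real^3) set" where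
  "endpoints S = {x. \<exists>y. S = closed_segment x y}"

text \<open>The interior of a segment is its interior within the line that it spans,
  and two segments lie on the same line iff their union is collinear.\<close>

definition segment_rep3 :: "'a set \<Rightarrow> 'a set set \<Rightarrow> ('a \<Rightarrow> (real^3) set) \<Rightarrow> bool" where
  "segment_rep3 V E B \<longleftrightarrow> box_rep3 V E B \<and>
     (\<forall>v\<in>V. segment3 (B v)) \<and>
     (\<forall>u\<in>V. \<forall>v\<in>V. u \<noteq> v \<longrightarrow>
        rel_interior (B u) \<inter> rel_interior (B v) = {} \<and>
        rel_interior (B u) \<inter> B v \<subseteq> endpoints (B v)) \<and>
     (\<forall>u\<in>V. \<forall>v\<in>V. u \<noteq> v \<longrightarrow> \<not> collinear (B u \<union> B v))"

lemma endpoints_closed_segment: "endpoints (closed_segment a b) = {a, b}"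
  by (auto simp: endpoints_def closed_segment_eq doubleton_eq_iff)

lemma cbox_eq_closed_segment:
  fixes a b :: "real^3"
  assumes "a $ k < b $ k" and "\<And>i. i \<noteq> k \<Longrightarrow> a $ i = b $ i"
  shows "cbox a b = closed_segment a b"
proof (intro set_eqI iffI)
  fix x assume x: "x \<in> cbox a b"
  define t where "t = (x $ k - a $ k) / (b $ k - a $ k)"
  have xk: "a $ k \<le> x $ k" "x $ k \<le> b $ k" using x by (auto simp: mem_box_cart)
  have "0 \<le> t" "t \<le> 1" using xk assms(1) by (auto simp: t_def field_simps)
  moreover have "x $ i = (1 - t) * a $ i + t * b $ i" for i
  proof (cases "i = k")
    case True
    have "t * (b $ k - a $ k) = x $ k - a $ k" using assms(1) by (simp add: t_def)
    then show ?thesis using True by (simp add: algebra_simps)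
  next
    case False
    have "a $ i \<le> x $ i" "x $ i \<le> b $ i" using x by (auto simp: mem_box_cart)
    then show ?thesis using assms(2)[OF False] by (simp add: algebra_simps)
  qed
  then have "x = (1 - t) *\<^sub>R a + t *\<^sub>R b" by (simp add: vec_eq_iff)
  ultimately show "x \<in> closed_segment a b" by (auto simp: in_segment)
next
  fix x assume x: "x \<in> closed_segment a b"
  have "a $ i \<le> b $ i" for i using assms by (cases "i = k") auto
  then have "a \<in> cbox a b" "b \<in> cbox a b" by (auto simp: mem_box_cart)
  then have "closed_segment a b \<subseteq> cbox a b"
    by (intro closed_segment_subset) auto
  with x show "x \<in> cbox a b" by blast
qed

end

theory Submission
  imports Defs
begin

text \<open>The proof is an induction on the number of vertices: remove a vertex of degree at most one,
  or the five inner vertices \<open>x1, \<dots>, x5\<close> of a path from \<open>a\<close> to \<open>b\<close>, represent the rest, and put the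
  removed vertices back. The segments drawn so far involve only finitely many coordinate values, so
  new coordinates can be taken to be generic, that is, different from all of these.

  A vertex attached to a single vertex \<open>a\<close> becomes a twig (\<open>ex_twig\<close>): a segment that leaves the
  segment of \<open>a\<close> orthogonally from a generic point and is too short to reach anything else. For a
  path, \<open>x1\<close> and \<open>x5\<close> become twigs at \<open>a\<close> and \<open>b\<close>. Their tips \<open>p\<close> and \<open>q\<close> are then joined by
  \<open>x2, x3, x4\<close>, drawn in three different axis directions, so that together they realise any
  displacement \<open>q - p\<close>. The tip of a twig has two generic coordinates, and the third one is
  inherited from the segment that carries the twig; choosing the direction of \<open>x2\<close> and of \<open>x4\<close> to be
  that of the inherited coordinate at \<open>p\<close> and \<open>q\<close> makes both fixed coordinates of each of
  \<open>x2, x3, x4\<close> generic. A line with two generic fixed coordinates misses every old segment, since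
  any two axis-parallel segments have a common coordinate in which both are fixed
  (\<open>apart_if_generic\<close>). Both for \<open>x2\<close> and for \<open>x4\<close> there are two directions orthogonal to the
  segment at that end, so that distinct ones can be chosen (\<open>extend_path\<close>).

  To keep the geometry out of the induction, segments are compared coordinatewise: two segments
  are \<open>apart\<close> or \<open>touching\<close>, and \<open>segment_rep3_contact_family\<close> translates these two relations into
  the conditions on a representation.\<close>

section \<open>Axis-parallel segments by coordinates\<close>

text \<open>The far end is recorded by a single coordinate, since it differs from the base only in the
  direction of the segment; the orientation is free, so \<open>reach\<close> may lie on either side of the base.\<close>

datatype seg = Seg (dir: 3) (base: "real^3") (reach: real)

definition tip :: "seg \<Rightarrow> real^3" where
  "tip s = (\<chi> i. if i = dir s then reach s else base s $ i)"

definition shadow :: "seg \<Rightarrow> 3 \<Rightarrow> real set" where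
  "shadow s i = (if i = dir s then closed_segment (base s $ i) (reach s) else {base s $ i})"

definition pts :: "seg \<Rightarrow> (real^3) set" where
  "pts s = {x. \<forall>i. x $ i \<in> shadow s i}"

definition coords :: "seg \<Rightarrow> real set" where
  "coords s = insert (reach s) (range (($) (base s)))"

definition nondegenerate :: "seg \<Rightarrow> bool" where
  "nondegenerate s \<longleftrightarrow> reach s \<noteq> base s $ dir s"

text \<open>Being separated by a coordinate in which both segments run would be enough for disjointness,
  but not for lying on different lines; a separating coordinate in which at least one of them is
  fixed gives both.\<close>

definition apart :: "seg \<Rightarrow> seg \<Rightarrow> bool" where
  "apart s t \<longleftrightarrow> (\<exists>i. shadow s i \<inter> shadow t i = {} \<and> (i \<noteq> dir s \<or> i \<noteq> dir t))"

definition touching :: "seg \<Rightarrow> seg \<Rightarrow> bool" where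
  "touching s t \<longleftrightarrow> dir s \<noteq> dir t \<and>
     pts s \<inter> pts t \<inter> ({base s, tip s} \<union> {base t, tip t}) \<noteq> {}"

lemma apart_sym: "apart s t \<longleftrightarrow> apart t s"
  unfolding apart_def by (metis Int_commute)

lemma touching_sym: "touching s t \<longleftrightarrow> touching t s"
  unfolding touching_def by (metis Int_commute Un_commute)

lemma tip_nth [simp]: "tip s $ i = (if i = dir s then reach s else base s $ i)"
  by (simp add: tip_def)

lemma base_in_pts: "base s \<in> pts s"
  by (simp add: pts_def shadow_def)

lemma tip_in_pts: "tip s \<in> pts s"
  by (simp add: pts_def shadow_def)

lemma finite_coords: "finite (coords s)"
  by (simp add: coords_def)

lemma base_in_coords: "base s $ i \<in> coords s"
  by (simp add: coords_def)

lemma tip_in_coords: "tip s $ i \<in> coords s"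
  by (simp add: coords_def)

lemma touching_if_common_end:
  assumes "dir s \<noteq> dir t" "x \<in> {base s, tip s}" "x \<in> {base t, tip t}"
  shows "touching s t"
proof -
  have "x \<in> pts s" "x \<in> pts t"
    using assms(2,3) base_in_pts tip_in_pts by auto
  then show ?thesis
    using assms(1,2) unfolding touching_def by blast
qed

lemma apart_if_fixed_coordinate:
  assumes "i \<noteq> dir s" "i \<noteq> dir t" "base s $ i \<noteq> base t $ i"
  shows "apart s t"
  using assms unfolding apart_def shadow_def by (intro exI[of _ i]) auto

text \<open>At most one of the two coordinates \<open>i\<close>, \<open>j\<close> is the direction of \<open>t\<close>, so \<open>t\<close> is fixed in the
  other one, at a value that \<open>s\<close> avoids.\<close>

lemma apart_if_generic:
  assumes "i \<noteq> j" "i \<noteq> dir s" "j \<noteq> dir s"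
    and "base s $ i \<notin> coords t" "base s $ j \<notin> coords t"
  shows "apart s t"
proof (cases "i = dir t")
  case True
  then show ?thesis
    using assms base_in_coords by (metis apart_if_fixed_coordinate)
next
  case False
  then show ?thesis
    using assms base_in_coords by (metis apart_if_fixed_coordinate)
qed

lemma apart_parallel:
  assumes "apart s t" "dir s = dir t"
  obtains i where "i \<noteq> dir s" "base s $ i \<noteq> base t $ i"
  using assms unfolding apart_def shadow_def by auto

section \<open>Contact families\<close>

text \<open>Only pairs of vertices in \<open>V\<close> are looked at, so the edge set need not be restricted when
  vertices are removed.\<close>

definition contact_family :: "'a set \<Rightarrow> 'a set set \<Rightarrow> ('a \<Rightarrow> seg) \<Rightarrow> bool" where
  "contact_family V E S \<longleftrightarrow> (\<forall>v\<in>V. nondegenerate (S v)) \<and>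
     (\<forall>u\<in>V. \<forall>v\<in>V. u \<noteq> v \<longrightarrow>
        (if {u, v} \<in> E then touching (S u) (S v) else apart (S u) (S v)))"

lemma contact_family_insert:
  assumes S: "contact_family V E S" and v: "v \<notin> V" and s: "nondegenerate s"
    and new: "\<And>u. u \<in> V \<Longrightarrow> if {v, u} \<in> E then touching s (S u) else apart s (S u)"
  shows "contact_family (insert v V) E (S(v := s))"
proof -
  have "if {u, w} \<in> E then touching ((S(v := s)) u) ((S(v := s)) w)
        else apart ((S(v := s)) u) ((S(v := s)) w)"
    if uw: "u \<in> insert v V" "w \<in> insert v V" "u \<noteq> w" for u w
  proof -
    consider "u = v" "w \<in> V" "w \<noteq> v" | "w = v" "u \<in> V" "u \<noteq> v"
      | "u \<in> V" "w \<in> V" "u \<noteq> v" "w \<noteq> v"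
      using uw v by blast
    then show ?thesis
    proof cases
      case 1
      then show ?thesis using new by simp
    next
      case 2
      then show ?thesis
        using new[of u] apart_sym touching_sym by (simp add: insert_commute)
    next
      case 3
      then show ?thesis using S that unfolding contact_family_def by simp
    qed
  qed
  moreover have "\<forall>w\<in>insert v V. nondegenerate ((S(v := s)) w)"
    using S s unfolding contact_family_def by simp
  ultimately show ?thesis
    unfolding contact_family_def by blast
qed

lemma ex_closed_segment_avoiding:
  fixes a b :: real
  assumes "finite F" "a \<noteq> b"
  shows "\<exists>y. y \<in> closed_segment a b \<and> y \<notin> F"
proof -
  have "infinite (closed_segment a b)"
    using assms(2) by (simp add: closed_segment_eq_real_ivl infinite_Icc_iff)
  then show ?thesis
    using assms(1) by (meson finite_subset subsetI)
qed

lemma ex_above_avoiding: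
  fixes a :: real
  assumes "finite C" "finite F"
  shows "\<exists>u>a. u \<notin> F \<and> {a<..u} \<inter> C = {}"
proof -
  define m where "m = Min (insert (a + 1) {c \<in> C. a < c})"
  have m: "a < m" "\<And>c. c \<in> C \<Longrightarrow> a < c \<Longrightarrow> m \<le> c"
    unfolding m_def using assms(1) by auto
  have "infinite {a<..<m}" using m(1) by (simp add: infinite_Ioo_iff)
  then obtain u where "u \<in> {a<..<m}" "u \<notin> F"
    using assms(2) by (meson finite_subset subsetI)
  then show ?thesis using m(2) by (intro exI[of _ u]) force
qed

text \<open>The twig leaves the segment of \<open>a\<close> at a point whose coordinate \<open>y\<close> along that segment occurs
  nowhere else; this keeps it away from all segments of another direction. A segment parallel to
  that of \<open>a\<close> is not on the same line, so it either lies off the plane of the twig and the segment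
  of \<open>a\<close>, or is at a positive distance in the direction of the twig; there are finitely many such
  distances and the twig is shorter than all of them. The set \<open>F\<close> stands for further values that
  the two free coordinates of the tip must avoid.\<close>

lemma ex_twig:
  assumes fin: "finite V" "finite F"
    and S: "contact_family V E S" and a: "a \<in> V" and d: "d \<noteq> dir (S a)"
  shows "\<exists>s. dir s = d \<and> nondegenerate s \<and> touching s (S a) \<and>
           (\<forall>v\<in>V. v \<noteq> a \<longrightarrow> apart s (S v)) \<and>
           (\<forall>i. tip s $ i \<in> F \<longrightarrow> i \<noteq> d \<and> i \<noteq> dir (S a)) \<and>
           (\<forall>i. i \<noteq> d \<longrightarrow> i \<noteq> dir (S a) \<longrightarrow> base s $ i = base (S a) $ i)"
proof -
  define C where "C = (\<Union>v\<in>V. coords (S v))"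
  define k where "k = dir (S a)"
  have finC: "finite C" using fin finite_coords by (simp add: C_def)
  have C: "base (S v) $ i \<in> C" if "v \<in> V" for v i
    using that base_in_coords by (auto simp: C_def)
  have "base (S a) $ k \<noteq> reach (S a)"
    using S a unfolding contact_family_def nondegenerate_def k_def by metis
  then obtain y where y: "y \<in> closed_segment (base (S a) $ k) (reach (S a))" "y \<notin> C \<union> F"
    using ex_closed_segment_avoiding[of "C \<union> F"] finC fin by auto
  obtain u where u: "u > base (S a) $ d" "u \<notin> F" "{base (S a) $ d<..u} \<inter> C = {}"
    using ex_above_avoiding[OF finC fin(2)] by blast
  define s where "s = Seg d (\<chi> i. if i = k then y else base (S a) $ i) u"
  have sd [simp]: "dir s = d" "reach s = u"
    "\<And>i. base s $ i = (if i = k then y else base (S a) $ i)"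
    by (auto simp: s_def)
  have dk: "d \<noteq> k" using d by (simp add: k_def)
  have "base s \<in> pts (S a)"
    using y by (auto simp: pts_def shadow_def k_def)
  then have t: "touching s (S a)"
    using dk base_in_pts unfolding touching_def k_def by auto
  have "apart s (S v)" if v: "v \<in> V" "v \<noteq> a" for v
  proof (cases "dir (S v) = k")
    case False
    have "y \<noteq> base (S v) $ k" using C v y by auto
    then show ?thesis
      using False dk by (intro apart_if_fixed_coordinate[of k]) auto
  next
    case True
    have "apart (S a) (S v)"
      using S a v True unfolding contact_family_def touching_def k_def by metis
    then obtain i where i: "i \<noteq> k" "base (S a) $ i \<noteq> base (S v) $ i"
      using True apart_parallel k_def by metis
    show ?thesis
    proof (cases "i = d")
      case False
      then show ?thesis
        using i True by (intro apart_if_fixed_coordinate[of i]) auto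
    next
      case id: True
      have "base (S v) $ d \<notin> {base (S a) $ d..u}"
        using C[OF v(1), of d] u(3) i(2) id by force
      then have "shadow s d \<inter> shadow (S v) d = {}"
        using dk True u(1) by (auto simp: shadow_def closed_segment_eq_real_ivl)
      then show ?thesis
        unfolding apart_def using True dk by metis
    qed
  qed
  then show ?thesis
    using t u y dk by (intro exI[of _ s]) (auto simp: nondegenerate_def k_def[symmetric])
qed

lemma ex_axis_avoiding: "\<exists>d::3. d \<noteq> i \<and> d \<noteq> j"
proof -
  have "card {i, j} < card (UNIV :: 3 set)" by (cases "i = j") auto
  then have "{i, j} \<noteq> UNIV" by force
  then show ?thesis by blast
qed

lemma axis_cases:
  fixes i j l x :: 3
  assumes "i \<noteq> j" "j \<noteq> l" "i \<noteq> l"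
  shows "x = i \<or> x = j \<or> x = l"
  using assms exhaust_3[of i] exhaust_3[of j] exhaust_3[of l] exhaust_3[of x] by metis

lemma extend_isolated:
  assumes fin: "finite V" and S: "contact_family V E S" and v: "v \<notin> V"
    and iso: "\<And>u. u \<in> V \<Longrightarrow> {v, u} \<notin> E"
  shows "\<exists>S. contact_family (insert v V) E S"
proof -
  have "finite (\<Union>u\<in>V. coords (S u))" using fin finite_coords by blast
  then obtain c where c: "c \<notin> (\<Union>u\<in>V. coords (S u))"
    using ex_new_if_finite infinite_UNIV_char_0 by blast
  define s where "s = Seg 1 (\<chi> i. c) (c + 1)"
  have "apart s (S u)" if "u \<in> V" for u
    using that c by (intro apart_if_generic[of 2 3]) (auto simp: s_def)
  then show ?thesis
    using contact_family_insert[OF S v, of s] iso by (auto simp: s_def nondegenerate_def)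
qed

lemma extend_pendant:
  assumes fin: "finite V" and S: "contact_family V E S" and v: "v \<notin> V" and a: "a \<in> V"
    and nb: "\<And>u. u \<in> V \<Longrightarrow> {v, u} \<in> E \<longleftrightarrow> u = a"
  shows "\<exists>S. contact_family (insert v V) E S"
proof -
  obtain d where d: "d \<noteq> dir (S a)" using ex_axis_avoiding by blast
  obtain s where "nondegenerate s" "touching s (S a)"
    "\<And>u. u \<in> V \<Longrightarrow> u \<noteq> a \<Longrightarrow> apart s (S u)"
    using ex_twig[OF fin finite.emptyI S a d] by blast
  then have "contact_family (insert v V) E (S(v := s))"
    using nb by (intro contact_family_insert[OF S v]) auto
  then show ?thesis by blast
qed

text \<open>The directions are chosen so that \<open>d2\<close>, \<open>d3\<close>, \<open>d4\<close> are the three axes and so that \<open>d2\<close> is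
  orthogonal to the segment of \<open>a\<close> and its twig, and \<open>d4\<close> to the segment of \<open>b\<close> and its twig. The
  segments go in in the order \<open>x1, x5, x2, x3, x4\<close>: the second twig is built against a family that
  already contains the first, which separates the twigs and makes the generic coordinates of the
  second tip different from all coordinates of the first twig.\<close>

lemma extend_path:
  fixes V :: "'a set"
  assumes fin: "finite V" and S: "contact_family V E S" and a: "a \<in> V" and b: "b \<in> V"
    and dist: "distinct [x1, x2, x3, x4, x5]"
    and fresh: "{x1, x2, x3, x4, x5} \<inter> V = {}"
    and nb1: "\<And>u. {x1, u} \<in> E \<longleftrightarrow> u = a \<or> u = x2"
    and nb2: "\<And>u. {x2, u} \<in> E \<longleftrightarrow> u = x1 \<or> u = x3"
    and nb3: "\<And>u. {x3, u} \<in> E \<longleftrightarrow> u = x2 \<or> u = x4"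
    and nb4: "\<And>u. {x4, u} \<in> E \<longleftrightarrow> u = x3 \<or> u = x5"
    and nb5: "\<And>u. {x5, u} \<in> E \<longleftrightarrow> u = x4 \<or> u = b"
  shows "\<exists>S. contact_family (V \<union> {x1, x2, x3, x4, x5}) E S"
proof -
  obtain d2 where d2: "d2 \<noteq> dir (S a)" using ex_axis_avoiding by blast
  obtain d4 where d4: "d4 \<noteq> dir (S b)" "d4 \<noteq> d2" using ex_axis_avoiding by blast
  obtain d3 where d3: "d3 \<noteq> d2" "d3 \<noteq> d4" using ex_axis_avoiding by blast
  obtain d1 where d1: "d1 \<noteq> dir (S a)" "d1 \<noteq> d2" using ex_axis_avoiding by blast
  obtain d5 where d5: "d5 \<noteq> dir (S b)" "d5 \<noteq> d4" using ex_axis_avoiding by blast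
  have xs: "x1 \<notin> V" "x2 \<notin> V" "x3 \<notin> V" "x4 \<notin> V" "x5 \<notin> V"
    using fresh by auto
  define C where "C = (\<Union>v\<in>V. coords (S v))"
  have finC: "finite C" using fin finite_coords by (simp add: C_def)
  have C: "coords (S v) \<subseteq> C" if "v \<in> V" for v using that by (auto simp: C_def)
  obtain s1 where s1: "dir s1 = d1" "nondegenerate s1" "touching s1 (S a)"
    "\<And>v. v \<in> V \<Longrightarrow> v \<noteq> a \<Longrightarrow> apart s1 (S v)"
    "\<And>i. tip s1 $ i \<in> C \<Longrightarrow> i \<noteq> d1 \<and> i \<noteq> dir (S a)"
    "\<And>i. i \<noteq> d1 \<Longrightarrow> i \<noteq> dir (S a) \<Longrightarrow> base s1 $ i = base (S a) $ i"
    using ex_twig[OF fin finC S a d1(1)] by blast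
  define S1 where "S1 = S(x1 := s1)"
  have S1: "contact_family (insert x1 V) E S1"
    unfolding S1_def using xs dist s1 nb1
    by (intro contact_family_insert[OF S]) auto
  have S1_eq: "S1 x1 = s1" "\<And>v. v \<in> V \<Longrightarrow> S1 v = S v"
    using xs by (auto simp: S1_def)
  obtain s5 where s5: "dir s5 = d5" "nondegenerate s5" "touching s5 (S b)"
    "\<And>v. v \<in> insert x1 V \<Longrightarrow> v \<noteq> b \<Longrightarrow> apart s5 (S1 v)"
    "\<And>i. tip s5 $ i \<in> C \<union> coords s1 \<Longrightarrow> i \<noteq> d5 \<and> i \<noteq> dir (S b)"
    "\<And>i. i \<noteq> d5 \<Longrightarrow> i \<noteq> dir (S b) \<Longrightarrow> base s5 $ i = base (S b) $ i"
    using ex_twig[of "insert x1 V" "C \<union> coords s1" E S1 b d5] fin finC finite_coords S1 b d5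
      S1_eq(2)[OF b] by auto
  define S2 where "S2 = S1(x5 := s5)"
  have S2: "contact_family (insert x5 (insert x1 V)) E S2"
    unfolding S2_def using xs dist s5 nb5 b S1_eq
    by (intro contact_family_insert[OF S1]) auto
  define p where "p = tip s1"
  define q where "q = tip s5"
  \<comment> \<open>Both tips are generic, except for the coordinates \<open>p $ d2\<close> and \<open>q $ d4\<close> inherited from the
    segments of \<open>a\<close> and \<open>b\<close>.\<close>
  have pC: "p $ i \<notin> C" if "i \<noteq> d2" for i
    using that s1(5)[of i] axis_cases[of d1 "dir (S a)" d2 i] d1 d2 unfolding p_def by metis
  have qC: "q $ i \<notin> C" "q $ i \<notin> coords s1" if "i \<noteq> d4" for i
    using that s5(5)[of i] axis_cases[of d5 "dir (S b)" d4 i] d5 d4 unfolding q_def by blast+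
  have b5: "base s5 $ d4 = q $ d4" "q $ d4 \<in> C"
    using s5(1) s5(6)[of d4] d4 d5 base_in_coords[of "S b" d4] C[OF b] by (auto simp: q_def)
  have p1: "p $ i \<in> coords s1" for i using tip_in_coords p_def by metis
  \<comment> \<open>In coordinate \<open>d4\<close> it is \<open>p\<close> that is new and \<open>q\<close> that is old; elsewhere \<open>q\<close> avoids the first twig.\<close>
  have pq: "p $ i \<noteq> q $ i" for i
    using p1[of i] qC(2)[of i] pC[of i] b5 d4 by metis
  \<comment> \<open>From \<open>p\<close>, first \<open>d2\<close> and then \<open>d3\<close> is adjusted to \<open>q\<close>; \<open>s4\<close> is drawn backwards from \<open>q\<close> and
    adjusts \<open>d4\<close> to \<open>p\<close>, so that the tips of \<open>s3\<close> and \<open>s4\<close> coincide.\<close>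
  define s2 where "s2 = Seg d2 p (q $ d2)"
  define s3 where "s3 = Seg d3 (tip s2) (q $ d3)"
  define s4 where "s4 = Seg d4 q (p $ d4)"
  have dirs [simp]: "dir s2 = d2" "dir s3 = d3" "dir s4 = d4"
    and bases [simp]: "base s2 = p" "base s3 = tip s2" "base s4 = q"
    and reaches [simp]: "reach s2 = q $ d2" "reach s3 = q $ d3" "reach s4 = p $ d4"
    by (simp_all add: s2_def s3_def s4_def)
  have nondeg: "nondegenerate s2" "nondegenerate s3" "nondegenerate s4"
    using pq d3 pq[symmetric] by (auto simp: nondegenerate_def)
  have "tip s3 = tip s4"
    using axis_cases[of d2 d3 d4] d3 d4 by (auto simp: vec_eq_iff)
  then have t34: "touching s4 s3"
    using d3 by (intro touching_if_common_end[of _ _ "tip s4"]) auto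
  have t23: "touching s3 s2"
    using d3 by (intro touching_if_common_end[of _ _ "tip s2"]) auto
  have t12: "touching s2 s1"
    using d1 s1(1) by (intro touching_if_common_end[of _ _ p]) (auto simp: p_def)
  have t45: "touching s4 s5"
    using d5 s5(1) by (intro touching_if_common_end[of _ _ q]) (auto simp: q_def)
  have a2: "apart s2 (S v)" if "v \<in> V" for v
    using pC C[OF that] d3 d4 by (intro apart_if_generic[of d3 d4]) auto
  have a3: "apart s3 (S v)" if "v \<in> V" for v
    using pC qC C[OF that] d3 d4 by (intro apart_if_generic[of d2 d4]) auto
  have a4: "apart s4 (S v)" if "v \<in> V" for v
    using qC C[OF that] d3 d4 by (intro apart_if_generic[of d2 d3]) auto
  have a14: "apart s4 s1"
    using qC d3 d4 by (intro apart_if_generic[of d2 d3]) auto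
  \<comment> \<open>A twig is fixed in its inherited coordinate, \<open>d2\<close> for \<open>s1\<close> and \<open>d4\<close> for \<open>s5\<close>. There the
    segments that do not meet the twig have a generic value.\<close>
  have a13: "apart s3 s1"
    using qC(2)[of d2] base_in_coords[of s1 d2] d1 d3 d4 s1(1)
    by (intro apart_if_fixed_coordinate[of d2]) auto
  have a25: "apart s2 s5"
    using pq b5(1) d4 d5 s5(1) by (intro apart_if_fixed_coordinate[of d4]) auto
  have a35: "apart s3 s5"
    using pq b5(1) d3 d4 d5 s5(1) by (intro apart_if_fixed_coordinate[of d4]) auto
  have a24: "apart s4 s2"
    using pq[symmetric] d3 by (intro apart_if_fixed_coordinate[of d3]) auto
  have S2_eq: "S2 x1 = s1" "S2 x5 = s5" "\<And>v. v \<in> V \<Longrightarrow> S2 v = S v"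
    using xs dist by (auto simp: S2_def S1_def)
  have ne: "u \<noteq> x1" "u \<noteq> x2" "u \<noteq> x3" "u \<noteq> x4" "u \<noteq> x5" if "u \<in> V" for u
    using xs that by auto
  have S3: "contact_family (insert x2 (insert x5 (insert x1 V))) E (S2(x2 := s2))"
    using xs dist nondeg nb2 t12 a25 a2 ne S2_eq
    by (intro contact_family_insert[OF S2]) auto
  have S4: "contact_family (insert x3 (insert x2 (insert x5 (insert x1 V)))) E
      (S2(x2 := s2, x3 := s3))"
    using xs dist nondeg nb3 t23 a13 a35 a3 ne S2_eq
    by (intro contact_family_insert[OF S3]) auto
  have S5: "contact_family (insert x4 (insert x3 (insert x2 (insert x5 (insert x1 V))))) E
      (S2(x2 := s2, x3 := s3, x4 := s4))"
    using xs dist nondeg nb4 t34 t45 a14 a24 a4 ne S2_eq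
    by (intro contact_family_insert[OF S4]) auto
  have "insert x4 (insert x3 (insert x2 (insert x5 (insert x1 V)))) = V \<union> {x1, x2, x3, x4, x5}"
    by auto
  then show ?thesis using S5 by metis
qed

section \<open>Induction over path-degenerate graphs\<close>

lemma simple_graph_finite_edges:
  assumes "simple_graph V E"
  shows "finite E"
proof (rule finite_subset)
  show "E \<subseteq> Pow V" "finite (Pow V)"
    using assms by (auto simp: simple_graph_def)
qed

lemma path_degenerate_subgraph:
  assumes "path_degenerate p V E" "subgraph W F V E"
  shows "path_degenerate p W F"
proof -
  have "subgraph W' F' V E" if "subgraph W' F' W F" for W' F'
    using that assms(2) by (auto simp: subgraph_def)
  then show ?thesis using assms(1) by (simp add: path_degenerate_def)
qed

lemma neighbours_if_degree_2:
  assumes "finite E" "degree E x = 2" "{u, x} \<in> E" "{x, w} \<in> E" "u \<noteq> w"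
  shows "{x, y} \<in> E \<longleftrightarrow> y = u \<or> y = w"
proof -
  have ne: "{u, x} \<noteq> {x, w}" using assms(5) by (auto simp: doubleton_eq_iff)
  have "{{u, x}, {x, w}} = {e \<in> E. x \<in> e}"
  proof (rule card_subset_eq)
    show "finite {e \<in> E. x \<in> e}" using assms(1) by simp
    show "{{u, x}, {x, w}} \<subseteq> {e \<in> E. x \<in> e}" using assms by auto
    show "card {{u, x}, {x, w}} = card {e \<in> E. x \<in> e}"
      using assms(2) ne by (simp add: degree_def)
  qed
  moreover have "{x, y} \<in> E \<longleftrightarrow> {x, y} \<in> {e \<in> E. x \<in> e}" by simp
  ultimately have "{x, y} \<in> E \<longleftrightarrow> {x, y} \<in> {{u, x}, {x, w}}" by metis
  also have "\<dots> \<longleftrightarrow> y = u \<or> y = w" by (auto simp: doubleton_eq_iff)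
  finally show ?thesis .
qed

lemma contact_family_exists:
  assumes "simple_graph V E" "path_degenerate 5 V E"
  shows "\<exists>S. contact_family V E S"
  using assms
proof (induction "card V" arbitrary: V E rule: less_induct)
  case less
  have fin: "finite V" "finite E"
    using less.prems simple_graph_finite_edges by (auto simp: simple_graph_def)
  have remove: "\<exists>S. contact_family (V - X) E S" if X: "X \<subseteq> V" "X \<noteq> {}" for X
  proof -
    define F where "F = {e \<in> E. e \<subseteq> V - X}"
    have "subgraph (V - X) F V E"
      using less.prems(1) fin by (auto simp: subgraph_def simple_graph_def F_def)
    moreover have "card (V - X) < card V"
      using X fin by (intro psubset_card_mono) auto
    ultimately obtain S where "contact_family (V - X) F S"
      using less.hyps less.prems(2) path_degenerate_subgraph
      unfolding subgraph_def by metis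
    then have "contact_family (V - X) E S"
      unfolding contact_family_def F_def by auto
    then show ?thesis by blast
  qed
  show ?case
  proof (cases "V = {}")
    case True
    then have "contact_family V E S" for S
      by (simp add: contact_family_def)
    then show ?thesis by blast
  next
    case False
    have "subgraph V E V E" using less.prems(1) by (simp add: subgraph_def)
    then consider v where "v \<in> V" "degree E v \<le> 1"
      | xs where "graph_path V E xs" "length xs = 7" "\<And>i. i \<in> {1..5} \<Longrightarrow> degree E (xs ! i) = 2"
      using less.prems(2) False unfolding path_degenerate_def by force
    then show ?thesis
    proof cases
      case 1
      obtain S where S: "contact_family (V - {v}) E S" using remove[of "{v}"] 1 by auto
      have ins: "insert v (V - {v}) = V" using 1 by auto
      show ?thesis
      proof (cases "\<exists>a\<in>V - {v}. {v, a} \<in> E")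
        case False
        then show ?thesis
          using extend_isolated[of "V - {v}" E S v] fin S ins by auto
      next
        case True
        then obtain a where a: "a \<in> V - {v}" "{v, a} \<in> E" by blast
        have "u = a" if "{v, u} \<in> E" for u
        proof -
          have "{v, u} = {v, a}"
            using 1(2) fin(2) a that card_le_Suc0_iff_eq[of "{e \<in> E. v \<in> e}"]
            by (auto simp: degree_def)
          then show ?thesis using a by (auto simp: doubleton_eq_iff)
        qed
        then have "{v, u} \<in> E \<longleftrightarrow> u = a" for u
          using a(2) by blast
        then show ?thesis
          using extend_pendant[OF _ S _ a(1), of v] fin ins by simp
      qed
    next
      case 2
      obtain a x1 x2 x3 x4 x5 b where xs: "xs = [a, x1, x2, x3, x4, x5, b]"
        using 2(2) by (auto simp: length_Suc_conv eval_nat_numeral)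
      have d: "distinct [a, x1, x2, x3, x4, x5, b]"
        and V: "{a, x1, x2, x3, x4, x5, b} \<subseteq> V"
        using 2(1) by (auto simp: graph_path_def xs)
      have step: "\<And>i. Suc i < 7 \<Longrightarrow> {xs ! i, xs ! Suc i} \<in> E"
        using 2(1,2) by (simp add: graph_path_def)
      have e: "{a, x1} \<in> E" "{x1, x2} \<in> E" "{x2, x3} \<in> E" "{x3, x4} \<in> E"
        "{x4, x5} \<in> E" "{x5, b} \<in> E"
        using step[of 0] step[of 1] step[of 2] step[of 3] step[of 4] step[of 5]
        by (simp_all add: xs eval_nat_numeral)
      have g: "degree E x1 = 2" "degree E x2 = 2" "degree E x3 = 2" "degree E x4 = 2"
        "degree E x5 = 2"
        using 2(3)[of 1] 2(3)[of 2] 2(3)[of 3] 2(3)[of 4] 2(3)[of 5]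
        by (simp_all add: xs eval_nat_numeral)
      let ?X = "{x1, x2, x3, x4, x5}"
      obtain S where S: "contact_family (V - ?X) E S" using remove[of ?X] V by auto
      have "\<exists>S. contact_family ((V - ?X) \<union> ?X) E S"
      proof (rule extend_path[OF _ S])
        show "finite (V - ?X)" using fin by simp
        show "a \<in> V - ?X" "b \<in> V - ?X" using d V by auto
        show "distinct [x1, x2, x3, x4, x5]" using d by simp
        show "?X \<inter> (V - ?X) = {}" by blast
        show "{x1, u} \<in> E \<longleftrightarrow> u = a \<or> u = x2" for u
          using neighbours_if_degree_2[OF fin(2) g(1) e(1,2)] d by simp
        show "{x2, u} \<in> E \<longleftrightarrow> u = x1 \<or> u = x3" for u
          using neighbours_if_degree_2[OF fin(2) g(2) e(2,3)] d by simp
        show "{x3, u} \<in> E \<longleftrightarrow> u = x2 \<or> u = x4" for u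
          using neighbours_if_degree_2[OF fin(2) g(3) e(3,4)] d by simp
        show "{x4, u} \<in> E \<longleftrightarrow> u = x3 \<or> u = x5" for u
          using neighbours_if_degree_2[OF fin(2) g(4) e(4,5)] d by simp
        show "{x5, u} \<in> E \<longleftrightarrow> u = x4 \<or> u = b" for u
          using neighbours_if_degree_2[OF fin(2) g(5) e(5,6)] d by simp
      qed
      moreover have "(V - ?X) \<union> ?X = V" using V by blast
      ultimately show ?thesis by simp
    qed
  qed
qed

section \<open>From contact families to segment representations\<close>

lemma pts_as_segment:
  assumes "nondegenerate s"
  obtains a b where "a $ dir s < b $ dir s" "\<forall>i. i \<noteq> dir s \<longrightarrow> a $ i = b $ i"
    "pts s = cbox a b" "pts s = closed_segment a b" "{a, b} = {base s, tip s}"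
proof -
  define a b where "a = (if base s $ dir s < reach s then base s else tip s)"
    and "b = (if base s $ dir s < reach s then tip s else base s)"
  have lt: "a $ dir s < b $ dir s"
    using assms by (auto simp: a_def b_def nondegenerate_def)
  have eq: "a $ i = b $ i" if "i \<noteq> dir s" for i
    using that by (auto simp: a_def b_def)
  have "x $ i \<in> shadow s i \<longleftrightarrow> a $ i \<le> x $ i \<and> x $ i \<le> b $ i" for x :: "real^3" and i
    using assms
    by (auto simp: shadow_def a_def b_def closed_segment_eq_real_ivl nondegenerate_def)
  then have "pts s = cbox a b"
    by (auto simp: pts_def mem_box_cart)
  moreover have "{a, b} = {base s, tip s}" by (auto simp: a_def b_def)
  ultimately show ?thesis
    using that[OF lt] eq cbox_eq_closed_segment[OF lt eq] by simp
qed

lemma segment3_pts: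
  assumes "nondegenerate s"
  shows "segment3 (pts s)" "box3 (pts s)"
proof -
  obtain a b where ab: "a $ dir s < b $ dir s" "\<forall>i. i \<noteq> dir s \<longrightarrow> a $ i = b $ i"
    "pts s = cbox a b" "pts s = closed_segment a b" "{a, b} = {base s, tip s}"
    using pts_as_segment[OF assms] .
  show "segment3 (pts s)"
    unfolding segment3_def using ab(1-3) by (intro exI[of _ "dir s"] exI[of _ a] exI[of _ b]) simp
  have "a $ i \<le> b $ i" for i using ab(1,2) by (cases "i = dir s") auto
  then show "box3 (pts s)" using ab(3) unfolding box3_def by blast
qed

lemma endpoints_pts:
  assumes "nondegenerate s"
  shows "endpoints (pts s) = {base s, tip s}"
proof (rule pts_as_segment[OF assms])
  fix a b
  assume "pts s = closed_segment a b" "{a, b} = {base s, tip s}"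
  then show "endpoints (pts s) = {base s, tip s}"
    by (metis endpoints_closed_segment)
qed

lemma rel_interior_pts:
  assumes "nondegenerate s"
  shows "rel_interior (pts s) = pts s - {base s, tip s}"
proof -
  obtain a b where ab: "a $ dir s < b $ dir s" "\<forall>i. i \<noteq> dir s \<longrightarrow> a $ i = b $ i"
    "pts s = cbox a b" "pts s = closed_segment a b" "{a, b} = {base s, tip s}"
    using pts_as_segment[OF assms] .
  have "a \<noteq> b" using ab(1) by auto
  then show ?thesis
    using ab(4,5) by (simp add: rel_interior_closed_segment open_segment_def)
qed

text \<open>A line that contains a nondegenerate axis-parallel segment has the direction of that segment,
  so all other coordinates are constant on it.\<close>

lemma collinear_pts_constant:
  assumes "nondegenerate s" "collinear A" "pts s \<subseteq> A" "x \<in> A" "y \<in> A" "i \<noteq> dir s"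
  shows "x $ i = y $ i"
proof -
  obtain u where u: "\<forall>x\<in>A. \<forall>y\<in>A. \<exists>c. x - y = c *\<^sub>R u"
    using assms(2) unfolding collinear_def by blast
  have "tip s \<in> A" "base s \<in> A"
    using assms(3) base_in_pts tip_in_pts by auto
  then obtain c where c: "tip s - base s = c *\<^sub>R u" using u by blast
  obtain d where d: "x - y = d *\<^sub>R u" using u assms(4,5) by blast
  have "reach s - base s $ dir s = c * u $ dir s" "0 = c * u $ i"
    using arg_cong[OF c, of "\<lambda>x. x $ dir s"] arg_cong[OF c, of "\<lambda>x. x $ i"] assms(6) by auto
  then have "u $ i = 0" using assms(1) by (auto simp: nondegenerate_def)
  then show ?thesis using arg_cong[OF d, of "\<lambda>x. x $ i"] by simp
qed

lemma not_collinear_if_dir_neq: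
  assumes "nondegenerate s" "nondegenerate t" "dir s \<noteq> dir t"
  shows "\<not> collinear (pts s \<union> pts t)"
proof
  assume "collinear (pts s \<union> pts t)"
  then have "tip t $ dir t = base t $ dir t"
    using assms base_in_pts[of t] tip_in_pts[of t]
    by (intro collinear_pts_constant[of s "pts s \<union> pts t"]) auto
  then show False using assms(2) by (simp add: nondegenerate_def)
qed

lemma not_collinear_if_apart:
  assumes "nondegenerate s" "nondegenerate t" "apart s t"
  shows "\<not> collinear (pts s \<union> pts t)"
proof (cases "dir s = dir t")
  case True
  then obtain i where i: "i \<noteq> dir s" "base s $ i \<noteq> base t $ i"
    using apart_parallel assms(3) by blast
  show ?thesis
  proof
    assume "collinear (pts s \<union> pts t)"
    then have "base s $ i = base t $ i"
      using assms(1) i(1) base_in_pts[of s] base_in_pts[of t]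
      by (intro collinear_pts_constant[of s "pts s \<union> pts t"]) auto
    then show False using i(2) by simp
  qed
qed (use assms not_collinear_if_dir_neq in blast)

lemma pts_disjoint_if_apart:
  assumes "apart s t"
  shows "pts s \<inter> pts t = {}"
  using assms unfolding apart_def pts_def by blast

lemma pts_Int_if_dir_neq:
  assumes "dir s \<noteq> dir t" "x \<in> pts s \<inter> pts t" "y \<in> pts s \<inter> pts t"
  shows "x = y"
proof -
  have sh: "x $ i \<in> shadow s i" "y $ i \<in> shadow s i" "x $ i \<in> shadow t i" "y $ i \<in> shadow t i" for i
    using assms(2,3) by (simp_all add: pts_def)
  have "x $ i = y $ i" for i
  proof (cases "i = dir s")
    case True
    then have "shadow t i = {base t $ i}" using assms(1) by (simp add: shadow_def)
    then show ?thesis using sh[of i] by simp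
  next
    case False
    then have "shadow s i = {base s $ i}" by (simp add: shadow_def)
    then show ?thesis using sh[of i] by simp
  qed
  then show ?thesis by (simp add: vec_eq_iff)
qed

text \<open>Touching segments meet in one point only, as their directions differ, and \<open>touching\<close> provides
  a common point that is an end of one of them. Hence every common point is such an end, which is
  what the conditions on the interiors amount to.\<close>

lemma segment_rep3_contact_family:
  assumes S: "contact_family V E S"
  shows "segment_rep3 V E (\<lambda>v. pts (S v))"
proof -
  have nd: "nondegenerate (S v)" if "v \<in> V" for v
    using S that unfolding contact_family_def by blast
  have pair: "(pts (S u) \<inter> pts (S v) \<noteq> {} \<longleftrightarrow> {u, v} \<in> E) \<and>
      pts (S u) \<inter> pts (S v) \<subseteq> {base (S u), tip (S u)} \<union> {base (S v), tip (S v)} \<and>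
      \<not> collinear (pts (S u) \<union> pts (S v))"
    if uv: "u \<in> V" "v \<in> V" "u \<noteq> v" for u v
  proof (cases "{u, v} \<in> E")
    case True
    then have t: "touching (S u) (S v)" using S uv unfolding contact_family_def by metis
    then have neq: "dir (S u) \<noteq> dir (S v)" by (simp add: touching_def)
    obtain x where x: "x \<in> pts (S u) \<inter> pts (S v)"
      "x \<in> {base (S u), tip (S u)} \<union> {base (S v), tip (S v)}"
      using t unfolding touching_def by blast
    have "y = x" if "y \<in> pts (S u) \<inter> pts (S v)" for y
      using pts_Int_if_dir_neq[OF neq that x(1)] .
    then show ?thesis
      using True x not_collinear_if_dir_neq[OF nd nd neq] uv by blast
  next
    case False
    then have "apart (S u) (S v)" using S uv unfolding contact_family_def by metis
    then show ?thesis
      using False not_collinear_if_apart pts_disjoint_if_apart nd uv by (metis empty_subsetI)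
  qed
  have int: "rel_interior (pts (S u)) \<inter> rel_interior (pts (S v)) = {}"
    "rel_interior (pts (S u)) \<inter> pts (S v) \<subseteq> endpoints (pts (S v))"
    if "u \<in> V" "v \<in> V" "u \<noteq> v" for u v
    using pair[OF that] nd that by (auto simp: rel_interior_pts endpoints_pts)
  have adj: "pts (S u) \<inter> pts (S v) \<noteq> {} \<longleftrightarrow> {u, v} \<in> E"
    and ncol: "\<not> collinear (pts (S u) \<union> pts (S v))"
    if "u \<in> V" "v \<in> V" "u \<noteq> v" for u v
    using pair[OF that] by simp_all
  show ?thesis
    unfolding segment_rep3_def box_rep3_def
    by (intro conjI ballI impI) (rule segment3_pts nd adj int ncol | assumption)+
qed

theorem theorem14:
  fixes V :: "'a set" and E :: "'a set set"
  assumes "simple_graph V E" and "path_degenerate 5 V E"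
  shows "\<exists>B :: 'a \<Rightarrow> (real^3) set. segment_rep3 V E B"
  using contact_family_exists[OF assms] segment_rep3_contact_family by blast

end
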